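(* Let $p(z)=a_0z^n+a_1z^{n-1}+\dots+a_n$ be a polynomial of degree $n$ with real coefficients and $a_0>0$. Then $p$ is quasi-stable if and only if its infinite Hurwitz matrix $H_\infty(p)$ is totally nonnegative.
   Context: A polynomial is quasi-stable if all its zeroes lie in the closed left half-plane $\{z\in\mathbb{C}:\operatorname{Re}z\leqslant 0\}$. Put $a_i=0$ for $i<0$ and $i>n$. The infinite Hurwitz matrix of $p$ is the matrix $H_\infty(p)$ whose entry in row $r$ and column $s$ ($r,s=1,2,3,\dots$) is $a_{2s-r-1}$, i.e. $$H_{\infty}(p)=\begin{pmatrix} a_0&a_2&a_4&a_6&\dots\\ 0&a_1&a_3&a_5&\dots\\ 0&a_0&a_2&a_4&\dots\\ 0&0&a_1&a_3&\dots\\ \vdots&\vdots&\vdots&\vdots&\ddots\end{pmatrix}.$$ A (finite or infinite) matrix is totally nonnegative if all its minors (of finite order) are nonnegative. *)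

theory Defs
  imports Complex_Main "HOL-Computational_Algebra.Polynomial" "Jordan_Normal_Form.Determinant"
begin

definition quasi_stable :: "complex poly \<Rightarrow> bool" where
  "quasi_stable p \<longleftrightarrow> (\<forall>z. poly p z = 0 \<longrightarrow> Re z \<le> 0)"

text \<open>
  Coefficients are numbered from the leading one downwards: the number \<open>a\<^sub>i\<close> is the coefficient
  of the power \<open>n - i\<close>, where \<open>n\<close> is the degree, and \<open>a\<^sub>i = 0\<close> for \<open>i < 0\<close> and \<open>i > n\<close>.
\<close>

definition desc_coeff :: "'a::zero poly \<Rightarrow> int \<Rightarrow> 'a" where
  "desc_coeff p i =
     (if 0 \<le> i \<and> i \<le> int (degree p) then coeff p (degree p - nat i) else 0)"

lemma poly_desc_coeff:
  fixes p :: "'a::comm_semiring_1 poly"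
  shows "poly p z = (\<Sum>i\<le>degree p. desc_coeff p (int i) * z ^ (degree p - i))"
proof -
  have "poly p z = (\<Sum>i\<le>degree p. coeff p i * z ^ i)"
    by (rule poly_altdef)
  also have "\<dots> = (\<Sum>i\<le>degree p. coeff p (degree p - i) * z ^ (degree p - i))"
    by (rule sum.reindex_bij_witness[of _ "\<lambda>i. degree p - i" "\<lambda>i. degree p - i"]) auto
  also have "\<dots> = (\<Sum>i\<le>degree p. desc_coeff p (int i) * z ^ (degree p - i))"
    by (rule sum.cong) (auto simp: desc_coeff_def)
  finally show ?thesis .
qed

text \<open>Rows and columns are numbered from 1; values at index 0 are junk.\<close>

definition infinite_hurwitz_matrix :: "'a::zero poly \<Rightarrow> nat \<Rightarrow> nat \<Rightarrow> 'a" where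
  "infinite_hurwitz_matrix p r s = desc_coeff p (2 * int s - int r - 1)"

text \<open>
  A matrix with (finite or infinite) row index set \<open>R\<close> and column index set \<open>C\<close> is a function
  \<open>A\<close> considered on \<open>R \<times> C\<close> only. A minor of order \<open>k\<close> is given by strictly increasing selections
  of \<open>k\<close> row indices and \<open>k\<close> column indices; the one of order 0 equals 1.
\<close>

definition totally_nonnegative_on ::
    "nat set \<Rightarrow> nat set \<Rightarrow> (nat \<Rightarrow> nat \<Rightarrow> real) \<Rightarrow> bool" where
  "totally_nonnegative_on R C A \<longleftrightarrow>
     (\<forall>k rs cs. strict_mono_on {..<k} rs \<longrightarrow> rs ` {..<k} \<subseteq> R \<longrightarrow>
                strict_mono_on {..<k} cs \<longrightarrow> cs ` {..<k} \<subseteq> C \<longrightarrow>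
                0 \<le> det (mat k k (\<lambda>(i, j). A (rs i) (cs j))))"

end

theory Submission
  imports "HOL-Complex_Analysis.Conformal_Mappings"
    "HOL-Computational_Algebra.Fundamental_Theorem_Algebra" Defs
begin

text \<open>
  Every array here has the form \<open>H r s = a (2 s - r - 1)\<close> for a finitely supported real
  sequence \<open>a\<close>. Minors are multilinear in the rows, so replacing each row by a nonnegative
  combination of rows turns a minor into a nonnegative combination of minors; if the combined rows
  come in blocks that follow one another, all these minors have their rows in increasing order and
  are nonnegative. This single fact (\<open>det_row_combinations_ge\<close>) is used three times below.

  Let \<open>p\<close> be quasi-stable. Split \<open>p = P0 + P1\<close> into the part \<open>P0\<close> whose exponents
  have the parity of the degree and the remaining part \<open>P1\<close>, and let \<open>q = p - (a 0 / a 1) z P1\<close> be the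
  result of one step of Routh's algorithm; it has degree one less. Each row of the array of \<open>p\<close> is
  a row of the array of \<open>q\<close>, possibly plus \<open>a 0 / a 1\<close> times the preceding row, so total nonnegativity
  passes from \<open>q\<close> to \<open>p\<close>. It remains to see that \<open>q\<close> is quasi-stable. Reflecting a point of the
  right half-plane in the imaginary axis brings it nearer to every zero of \<open>p\<close> off that axis and
  keeps its distance to the others. Not all zeros are on the axis if \<open>a 1 > 0\<close>, hence
  \<open>\<bar>p (- z)\<bar> < \<bar>p z\<bar>\<close> there, which says that \<open>P0 / P1\<close> has positive real part. So the real part of
  \<open>q / P1 = 1 + P0 / P1 - (a 0 / a 1) z\<close> has lower limits at least 1 on the imaginary axis, and
  \<open>q / P1\<close> tends to 1 at infinity; by the minimum principle the real part is at least 1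
  throughout the half-plane, and \<open>q\<close> has no zero there. When \<open>a 1 = 0\<close> the division is impossible; therefore
  \<open>p\<close> is first replaced by \<open>p + \<epsilon> p'\<close>, which is quasi-stable because \<open>p' / p\<close> has nonnegative real
  part in the half-plane, and minors are continuous in \<open>\<epsilon>\<close>.

  Conversely, let the array of \<open>p\<close> be totally nonnegative. If \<open>p z = 0\<close>, the powers of \<open>z\<close> are annihilated by
  the columns: \<open>\<Sum>r. z ^ r * H r s = 0\<close>. So the oscillating real sequence \<open>y r = Im (z ^ r)\<close>
  is a left kernel vector of \<open>H\<close>. If \<open>z\<close> lies in the open first quadrant, its argument is below
  \<open>pi / 2\<close>, so each run of constant sign of \<open>y\<close> has at least two rows, and long windows have
  markedly more than two rows per run on average. A column shift by one moves the
  nonzero entries by two rows, so a long window of rows contains the full support of as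
  many columns as there are sign runs. Adding up the rows of each run with weights \<open>\<bar>y r\<bar>\<close> gives
  a square matrix annihilated by an alternating vector of signs. On the other hand its
  determinant is a sum of nonnegative terms, one of which is positive. To guarantee the
  positive term, \<open>p\<close> is first multiplied by a power of \<open>z + 1\<close>: this keeps the zero
  and total nonnegativity, and makes enough minors strictly positive
  (\<open>shift_add_minor_pos\<close>). Zeros on the positive real axis are impossible since all coefficients
  are nonnegative, and zeros in the fourth quadrant are conjugate to zeros in the first.
\<close>

section \<open>Minors of nonnegative row combinations\<close>

abbreviation minor :: "(nat \<Rightarrow> nat \<Rightarrow> real) \<Rightarrow> nat \<Rightarrow> (nat \<Rightarrow> nat) \<Rightarrow> (nat \<Rightarrow> nat) \<Rightarrow> real" where
  "minor A k rs cs \<equiv> Determinant.det (Matrix.mat k k (\<lambda>(i, j). A (rs i) (cs j)))"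

abbreviation totally_nonnegative :: "(nat \<Rightarrow> nat \<Rightarrow> real) \<Rightarrow> bool" where
  "totally_nonnegative A \<equiv> totally_nonnegative_on {1..} {1..} A"

lemma det_mat_permutations:
  fixes M :: "nat \<Rightarrow> nat \<Rightarrow> real"
  shows "Determinant.det (Matrix.mat k k (\<lambda>(i, j). M i j)) =
    (\<Sum>p | p permutes {0..<k}. signof p * (\<Prod>i = 0..<k. M i (p i)))"
  by (auto simp: Determinant.det_def permutes_in_image intro!: sum.cong prod.cong)

text \<open>The first \<open>j\<close> rows vanish to the right of the diagonal, the others to the left of it. A permutation that picks no zero satisfies \<open>p i \<le> i\<close> on the first rows and
  \<open>p i \<ge> i\<close> on the others, which forces it to be the identity from both ends.\<close>

lemma det_eq_prod_diagonal:
  fixes M :: "nat \<Rightarrow> nat \<Rightarrow> real"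
  assumes lower: "\<And>i l. i < j \<Longrightarrow> i < l \<Longrightarrow> l < k \<Longrightarrow> M i l = 0"
    and upper: "\<And>i l. j \<le> i \<Longrightarrow> i < k \<Longrightarrow> l < i \<Longrightarrow> M i l = 0"
  shows "Determinant.det (Matrix.mat k k (\<lambda>(i, l). M i l)) = (\<Prod>i<k. M i i)"
proof -
  have vanish: "signof p * (\<Prod>i = 0..<k. M i (p i)) = 0" if p: "p permutes {0..<k}" "p \<noteq> id" for p
  proof (rule ccontr)
    assume "\<not> ?thesis"
    then have "(\<Prod>i = 0..<k. M i (p i)) \<noteq> 0" by auto
    then have nz: "M i (p i) \<noteq> 0" if "i < k" for i
      using that by auto
    have pk: "p i < k" if "i < k" for i
      using permutes_in_image[OF p(1), of i] that by auto
    have inj: "p i = p l \<Longrightarrow> i = l" for i l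
      using permutes_inj[OF p(1)] by (auto dest: injD)
    have low: "p i = i" if "i < j" "i < k" for i
      using that
    proof (induction i rule: less_induct)
      case (less i)
      have "p i \<le> i"
        using lower[of i "p i"] nz[of i] pk[of i] less.prems by force
      moreover have "\<not> p i < i"
        using less.IH[of "p i"] less.prems inj[of "p i" i] by auto
      ultimately show ?case by simp
    qed
    have high: "p i = i" if "j \<le> i" "i < k" for i
      using that
    proof (induction "k - i" arbitrary: i rule: less_induct)
      case less
      have "i \<le> p i"
        using upper[of i "p i"] nz[of i] less.prems by force
      moreover have "\<not> i < p i"
        using less.hyps[of "p i"] less.prems inj[of "p i" i] pk[of i] by auto
      ultimately show ?case by simp
    qed
    have "p i = i" for i
    proof (cases "i < k")
      case True
      then show ?thesis using low[of i] high[of i] by linarith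
    next
      case False
      then show ?thesis using p(1) by (simp add: permutes_def)
    qed
    then have "p = id" by (simp add: fun_eq_iff)
    with p(2) show False by contradiction
  qed
  have "Determinant.det (Matrix.mat k k (\<lambda>(i, l). M i l)) =
      (\<Sum>p | p permutes {0..<k}. signof p * (\<Prod>i = 0..<k. M i (p i)))"
    by (rule det_mat_permutations)
  also have "\<dots> = (\<Sum>p\<in>{id}. signof p * (\<Prod>i = 0..<k. M i (p i)))"
    by (rule sum.mono_neutral_right) (auto simp: finite_permutations permutes_id vanish simp del: mult_eq_0_iff)
  also have "\<dots> = (\<Prod>i<k. M i i)"
    by (simp add: sign_id atLeast0LessThan)
  finally show ?thesis .
qed

lemma det_eq_0_left_kernel:
  fixes M :: "nat \<Rightarrow> nat \<Rightarrow> real"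
  assumes ker: "\<And>l. l < k \<Longrightarrow> (\<Sum>i<k. v i * M i l) = 0" and "i < k" "v i \<noteq> 0"
  shows "Determinant.det (Matrix.mat k k (\<lambda>(i, l). M i l)) = 0"
proof -
  let ?M = "Matrix.mat k k (\<lambda>(i, l). M i l)" and ?v = "Matrix.vec k v"
  have "?v \<noteq> 0\<^sub>v k"
    using assms(2,3) by (metis index_vec index_zero_vec(1))
  moreover have "transpose_mat ?M *\<^sub>v ?v = 0\<^sub>v k"
  proof (rule eq_vecI)
    fix l assume l: "l < dim_vec (0\<^sub>v k :: real Matrix.vec)"
    have "vec_index (transpose_mat ?M *\<^sub>v ?v) l = (\<Sum>i<k. v i * M i l)"
      using l by (auto simp: scalar_prod_def atLeast0LessThan mult.commute intro!: sum.cong)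
    with ker l show "vec_index (transpose_mat ?M *\<^sub>v ?v) l = vec_index (0\<^sub>v k) l"
      by simp
  qed simp
  ultimately have "Determinant.det (transpose_mat ?M) = 0"
    by (subst det_0_iff_vec_prod_zero_field[of _ k]) (auto intro!: exI[of _ ?v])
  then show ?thesis
    by (subst (asm) Determinant.det_transpose[of _ k]) auto
qed

lemma det_row_combinations:
  fixes A :: "nat \<Rightarrow> nat \<Rightarrow> real"
  assumes "finite S"
  shows "Determinant.det (Matrix.mat k k (\<lambda>(i, j). \<Sum>r\<in>S. w i r * A r (cs j))) =
    (\<Sum>f\<in>{f. (\<forall>i\<in>{0..<k}. f i \<in> S) \<and> (\<forall>i. i \<notin> {0..<k} \<longrightarrow> f i = i)}.
       (\<Prod>i\<in>{0..<k}. w i (f i)) * minor A k f cs)"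
proof -
  define R where "R r = Matrix.vec k (\<lambda>j. A r (cs j))" for r
  define a where "a i r = w i r \<cdot>\<^sub>v R r" for i r
  have a: "a \<in> {0..<k} \<rightarrow> S \<rightarrow> carrier_vec k"
    by (auto simp: a_def R_def)
  have ent: "vec_index (finsum_vec TYPE(real) k (a i) S) j = (\<Sum>r\<in>S. w i r * A r (cs j))"
    if "j < k" for i j
  proof -
    have "vec_index (finsum_vec TYPE(real) k (a i) S) j = (\<Sum>r\<in>S. vec_index (a i r) j)"
      by (rule index_finsum_vec) (use assms that in \<open>auto simp: a_def R_def\<close>)
    then show ?thesis using that by (simp add: a_def R_def)
  qed
  have "Matrix.mat k k (\<lambda>(i, j). \<Sum>r\<in>S. w i r * A r (cs j)) =
      mat\<^sub>r k k (\<lambda>i. finsum_vec TYPE(real) k (a i) S)"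
    by (rule eq_matI) (auto simp: ent)
  moreover have "Determinant.det (mat\<^sub>r k k (\<lambda>i. a i (f i))) =
      (\<Prod>i\<in>{0..<k}. w i (f i)) * minor A k f cs" for f
  proof -
    have "Determinant.det (mat\<^sub>r k k (\<lambda>i. a i (f i))) =
        (\<Prod>i\<in>{0..<k}. w i (f i)) * Determinant.det (mat\<^sub>r k k (\<lambda>i. R (f i)))"
      unfolding a_def by (rule det_rows_mul) (auto simp: R_def)
    also have "mat\<^sub>r k k (\<lambda>i. R (f i)) = Matrix.mat k k (\<lambda>(i, j). A (f i) (cs j))"
      by (rule eq_matI) (auto simp: R_def)
    finally show ?thesis .
  qed
  ultimately show ?thesis
    using det_linear_rows_sum[OF assms a] by simp
qed

text \<open>Expanding a determinant along sums of rows also produces repeated rows; those terms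
  vanish, so weakly increasing selections are as good as strictly increasing ones.\<close>

lemma minor_weakly_increasing_nonneg:
  assumes A: "totally_nonnegative A"
    and cs: "strict_mono_on {..<k} cs" "cs ` {..<k} \<subseteq> {1..}"
    and f: "\<And>i j. i < j \<Longrightarrow> j < k \<Longrightarrow> f i \<le> f j" "f ` {..<k} \<subseteq> {1..}"
  shows "minor A k f cs \<ge> 0"
proof (cases "strict_mono_on {..<k} f")
  case True
  then show ?thesis
    using A cs f unfolding totally_nonnegative_on_def by blast
next
  case False
  then obtain i j where ij: "i < j" "j < k" "f j \<le> f i"
    unfolding strict_mono_on_def by (auto simp: not_less)
  with f(1) have eq: "f i = f j" by (meson antisym)
  have "minor A k f cs = 0"
    by (rule det_identical_rows[of _ k i j])
       (use ij eq in \<open>auto intro!: eq_vecI\<close>)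
  then show ?thesis by simp
qed

lemma totally_nonnegative_entry:
  assumes "totally_nonnegative A" "r \<ge> 1" "s \<ge> 1"
  shows "A r s \<ge> 0"
proof -
  have "0 \<le> minor A 1 (\<lambda>_. r) (\<lambda>_. s)"
    by (rule minor_weakly_increasing_nonneg[OF assms(1)])
       (use assms in \<open>auto simp: strict_mono_on_def\<close>)
  then show ?thesis by (simp add: det_single)
qed

text \<open>The ordering hypothesis says that the row blocks follow one another, so that every
  selection of one row per block is weakly increasing and every term of the multilinear expansion is
  nonnegative. Dropping all but one term gives the bound, which yields both
  nonnegativity and, for a well chosen \<open>f\<close>, strict positivity. Consecutive blocks may share a row,
  as happens for bidiagonal combinations.\<close>

lemma det_row_combinations_ge:
  assumes A: "totally_nonnegative A"
    and S: "finite S" "S \<subseteq> {1..}"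
    and cs: "strict_mono_on {..<k} cs" "cs ` {..<k} \<subseteq> {1..}"
    and w: "\<And>i r. i < k \<Longrightarrow> w i r \<ge> 0"
    and ord: "\<And>i j r r'. i < j \<Longrightarrow> j < k \<Longrightarrow> r \<in> S \<Longrightarrow> r' \<in> S \<Longrightarrow> w i r \<noteq> 0 \<Longrightarrow> w j r' \<noteq> 0 \<Longrightarrow> r \<le> r'"
    and f: "\<And>i. i < k \<Longrightarrow> f i \<in> S"
  shows "(\<Prod>i<k. w i (f i)) * minor A k f cs
    \<le> Determinant.det (Matrix.mat k k (\<lambda>(i, j). \<Sum>r\<in>S. w i r * A r (cs j)))"
proof -
  let ?F = "{f. (\<forall>i\<in>{0..<k}. f i \<in> S) \<and> (\<forall>i. i \<notin> {0..<k} \<longrightarrow> f i = i)}"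
  let ?t = "\<lambda>f. (\<Prod>i\<in>{0..<k}. w i (f i)) * minor A k f cs"
  define g where "g i = (if i < k then f i else i)" for i
  have fin: "finite ?F"
    using S(1) by (intro finite_bounded_functions) auto
  have nonneg: "?t h \<ge> 0" if h: "h \<in> ?F" for h
  proof (cases "\<exists>i<k. w i (h i) = 0")
    case True
    then have "(\<Prod>i\<in>{0..<k}. w i (h i)) = 0"
      by (intro prod_zero) auto
    then show ?thesis by (simp only: mult_zero_left)
  next
    case False
    have "minor A k h cs \<ge> 0"
    proof (rule minor_weakly_increasing_nonneg[OF A cs])
      show "h i \<le> h j" if "i < j" "j < k" for i j
        using ord[of i j "h i" "h j"] False h that by auto
      show "h ` {..<k} \<subseteq> {1..}"
        using h S(2) by fastforce
    qed
    then show ?thesis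
      using w by (intro mult_nonneg_nonneg prod_nonneg) auto
  qed
  have "g \<in> ?F" using f by (auto simp: g_def)
  then have "?t g \<le> (\<Sum>h\<in>?F. ?t h)"
    by (intro member_le_sum nonneg fin) auto
  moreover have "minor A k g cs = minor A k f cs"
    by (rule arg_cong[of _ _ Determinant.det], rule eq_matI) (auto simp: g_def)
  moreover have "(\<Prod>i\<in>{0..<k}. w i (g i)) = (\<Prod>i<k. w i (f i))"
    by (rule prod.cong) (auto simp: g_def)
  ultimately show ?thesis
    using det_row_combinations[OF S(1), of k w A cs] by simp
qed

text \<open>Here the blocks are \<open>{r, r + 1}\<close>, and \<open>\<delta>\<close> says in which rows the second element is
  selected.\<close>

lemma minor_bidiagonal_ge:
  fixes A :: "nat \<Rightarrow> nat \<Rightarrow> real" and \<delta> :: "nat \<Rightarrow> bool"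
  assumes A: "totally_nonnegative A"
    and nonneg: "\<And>r. \<alpha> r \<ge> 0" "\<And>r. \<beta> r \<ge> 0"
    and rs: "strict_mono_on {..<k} rs" "rs ` {..<k} \<subseteq> {1..}"
    and cs: "strict_mono_on {..<k} cs" "cs ` {..<k} \<subseteq> {1..}"
  shows "(\<Prod>i<k. if \<delta> i then \<beta> (rs i) else \<alpha> (rs i)) * minor A k (\<lambda>i. rs i + of_bool (\<delta> i)) cs
    \<le> minor (\<lambda>r s. \<alpha> r * A r s + \<beta> r * A (Suc r) s) k rs cs"
proof -
  define S where "S = rs ` {..<k} \<union> Suc ` rs ` {..<k}"
  define w where "w i r = (if r = rs i then \<alpha> (rs i) else if r = Suc (rs i) then \<beta> (rs i) else 0)"
    for i r
  have S: "finite S" "S \<subseteq> {1..}"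
    using rs(2) by (auto simp: S_def)
  have ent: "(\<Sum>r\<in>S. w i r * A r s) = \<alpha> (rs i) * A (rs i) s + \<beta> (rs i) * A (Suc (rs i)) s"
    if "i < k" for i s
  proof -
    have "(\<Sum>r\<in>S. w i r * A r s) = (\<Sum>r\<in>{rs i, Suc (rs i)}. w i r * A r s)"
      by (rule sum.mono_neutral_right[OF S(1)]) (use that in \<open>auto simp: S_def w_def\<close>)
    then show ?thesis by (simp add: w_def)
  qed
  have "(\<Prod>i<k. w i (rs i + of_bool (\<delta> i))) * minor A k (\<lambda>i. rs i + of_bool (\<delta> i)) cs
    \<le> Determinant.det (Matrix.mat k k (\<lambda>(i, j). \<Sum>r\<in>S. w i r * A r (cs j)))"
  proof (rule det_row_combinations_ge[OF A S cs])
    show "w i r \<ge> 0" for i r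
      using nonneg by (simp add: w_def)
    show "rs i + of_bool (\<delta> i) \<in> S" if "i < k" for i
      using that by (auto simp: S_def)
    show "r \<le> r'" if "i < j" "j < k" "w i r \<noteq> 0" "w j r' \<noteq> 0" for i j r r'
    proof -
      have "rs i < rs j"
        using rs(1) that unfolding strict_mono_on_def by auto
      then show ?thesis
        using that(3,4) by (auto simp: w_def split: if_splits)
    qed
  qed
  also have "(\<Prod>i<k. w i (rs i + of_bool (\<delta> i))) = (\<Prod>i<k. if \<delta> i then \<beta> (rs i) else \<alpha> (rs i))"
    by (rule prod.cong) (auto simp: w_def)
  also have "Matrix.mat k k (\<lambda>(i, j). \<Sum>r\<in>S. w i r * A r (cs j)) =
      Matrix.mat k k (\<lambda>(i, j). \<alpha> (rs i) * A (rs i) (cs j) + \<beta> (rs i) * A (Suc (rs i)) (cs j))"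
    by (rule eq_matI) (auto simp: ent)
  finally show ?thesis .
qed

lemma totally_nonnegative_bidiagonal:
  fixes A :: "nat \<Rightarrow> nat \<Rightarrow> real"
  assumes A: "totally_nonnegative A"
    and nonneg: "\<And>r. \<alpha> r \<ge> 0" "\<And>r. \<beta> r \<ge> 0"
  shows "totally_nonnegative (\<lambda>r s. \<alpha> r * A r s + \<beta> r * A (Suc r) s)"
  unfolding totally_nonnegative_on_def
proof (intro allI impI)
  fix k :: nat and rs cs :: "nat \<Rightarrow> nat"
  assume rs: "strict_mono_on {..<k} rs" "rs ` {..<k} \<subseteq> {1..}"
    and cs: "strict_mono_on {..<k} cs" "cs ` {..<k} \<subseteq> {1..}"
  have "minor A k rs cs \<ge> 0"
    using A rs cs unfolding totally_nonnegative_on_def by blast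
  then have "0 \<le> (\<Prod>i<k. \<alpha> (rs i)) * minor A k rs cs"
    using nonneg by (intro mult_nonneg_nonneg prod_nonneg) auto
  also have "\<dots> \<le> minor (\<lambda>r s. \<alpha> r * A r s + \<beta> r * A (Suc r) s) k rs cs"
    using minor_bidiagonal_ge[OF A nonneg rs cs, of "\<lambda>_. False"] by simp
  finally show "0 \<le> minor (\<lambda>r s. \<alpha> r * A r s + \<beta> r * A (Suc r) s) k rs cs" .
qed

text \<open>A minor of \<open>A + \<epsilon> B\<close> is a polynomial in \<open>\<epsilon>\<close>, hence continuous at 0.\<close>

lemma totally_nonnegative_limit:
  fixes A B :: "nat \<Rightarrow> nat \<Rightarrow> real"
  assumes "\<And>\<epsilon>. \<epsilon> > 0 \<Longrightarrow> totally_nonnegative (\<lambda>r s. A r s + \<epsilon> * B r s)"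
  shows "totally_nonnegative A"
  unfolding totally_nonnegative_on_def
proof (intro allI impI)
  fix k :: nat and rs cs :: "nat \<Rightarrow> nat"
  assume rs: "strict_mono_on {..<k} rs" "rs ` {..<k} \<subseteq> {1..}"
    and cs: "strict_mono_on {..<k} cs" "cs ` {..<k} \<subseteq> {1..}"
  let ?m = "\<lambda>\<epsilon>. minor (\<lambda>r s. A r s + \<epsilon> * B r s) k rs cs"
  define F where "F \<epsilon> = (\<Sum>p | p permutes {0..<k}. signof p *
      (\<Prod>i = 0..<k. A (rs i) (cs (p i)) + \<epsilon> * B (rs i) (cs (p i))))" for \<epsilon> :: real
  have m: "?m \<epsilon> = F \<epsilon>" for \<epsilon>
    unfolding F_def by (rule det_mat_permutations)
  have "(F \<longlongrightarrow> F 0) (at_right 0)"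
    unfolding F_def by (intro tendsto_intros)
  moreover have "eventually (\<lambda>\<epsilon>. 0 \<le> F \<epsilon>) (at_right 0)"
    using eventually_at_right_less[of 0]
  proof eventually_elim
    case (elim \<epsilon>)
    then show ?case
      using assms[OF elim] rs cs unfolding totally_nonnegative_on_def m[symmetric] by blast
  qed
  ultimately have "0 \<le> F 0"
    by (intro tendsto_lowerbound) auto
  then show "0 \<le> minor A k rs cs" by (simp flip: m)
qed

section \<open>Arrays of Hurwitz shape\<close>

definition hurwitz_array :: "(int \<Rightarrow> real) \<Rightarrow> nat \<Rightarrow> nat \<Rightarrow> real" where
  "hurwitz_array a r s = a (2 * int s - int r - 1)"

lemma infinite_hurwitz_matrix_eq: "infinite_hurwitz_matrix p = hurwitz_array (desc_coeff p)"
  by (simp add: fun_eq_iff infinite_hurwitz_matrix_def hurwitz_array_def)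

text \<open>This is the array of a constant polynomial. It has at most one nonzero entry in each
  row and column, and these entries move to the right as one moves down. A permutation that contributes to a minor is therefore
  increasing, hence the identity, and no sign can occur.\<close>

lemma hurwitz_array_monomial_tnn:
  fixes a :: "int \<Rightarrow> real"
  assumes "a 0 \<ge> 0" and supp: "\<And>i. i \<noteq> 0 \<Longrightarrow> a i = 0"
  shows "totally_nonnegative (hurwitz_array a)"
  unfolding totally_nonnegative_on_def
proof (intro allI impI)
  fix k :: nat and rs cs :: "nat \<Rightarrow> nat"
  assume rs: "strict_mono_on {..<k} rs" "rs ` {..<k} \<subseteq> {1..}"
    and cs: "strict_mono_on {..<k} cs" "cs ` {..<k} \<subseteq> {1..}"
  let ?e = "\<lambda>i j. hurwitz_array a (rs i) (cs j)"
  have a_nonneg: "a i \<ge> 0" for i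
    using assms by (cases "i = 0") auto
  have term_nonneg: "0 \<le> signof p * (\<Prod>i = 0..<k. ?e i (p i))" if p: "p permutes {0..<k}" for p
  proof (cases "\<exists>i<k. ?e i (p i) = 0")
    case True
    then have "(\<Prod>i = 0..<k. ?e i (p i)) = 0"
      by (intro prod_zero) auto
    then show ?thesis by (simp only: mult_zero_right order_refl)
  next
    case False
    have pos: "int (rs i) = 2 * int (cs (p i)) - 1" if "i < k" for i
      using False that supp[of "2 * int (cs (p i)) - int (rs i) - 1"]
      unfolding hurwitz_array_def by fastforce
    have pk: "p i < k" if "i < k" for i
      using permutes_in_image[OF p, of i] that by auto
    have "p i < p j" if "i < j" for i j
    proof (cases "j < k")
      case True
      then have "rs i < rs j"
        using rs(1) that unfolding strict_mono_on_def by auto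
      then have "cs (p i) < cs (p j)"
        using pos[of i] pos[of j] that True by linarith
      then have "\<not> p j \<le> p i"
        using cs(1) pk[of i] pk[of j] that True unfolding strict_mono_on_def
        by (metis lessThan_iff less_trans nat_less_le not_less order.strict_iff_not)
      then show ?thesis by simp
    next
      case False
      then have "p j = j"
        using p by (simp add: permutes_def)
      then show ?thesis
        using pk[of i] p that False by (cases "i < k") (auto simp: permutes_def)
    qed
    then have "strict_mono p" by (rule strict_monoI)
    then have "p = id"
      by (intro permutes_natset_ge[OF p]) (auto intro: strict_mono_imp_increasing)
    then show ?thesis
      using a_nonneg by (simp add: hurwitz_array_def prod_nonneg sign_id)
  qed
  have "minor (hurwitz_array a) k rs cs =
      (\<Sum>p | p permutes {0..<k}. signof p * (\<Prod>i = 0..<k. ?e i (p i)))"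
    by (rule det_mat_permutations)
  also have "\<dots> \<ge> 0"
    by (intro sum_nonneg term_nonneg) simp
  finally show "0 \<le> minor (hurwitz_array a) k rs cs" .
qed

text \<open>Passing from \<open>b\<close> to \<open>a\<close> is the inverse of a step of Routh's algorithm. Row \<open>r\<close> of a
  Hurwitz array holds the entries whose index has parity opposite to that of \<open>r\<close>, so the two recursions
  express odd rows and even rows of the new array through adjacent rows of the old one.\<close>

lemma hurwitz_array_routh_step:
  assumes b: "totally_nonnegative (hurwitz_array b)" and c: "c \<ge> 0"
    and even: "\<And>i. even i \<Longrightarrow> a i = c * b i + b (i - 1)"
    and odd: "\<And>i. odd i \<Longrightarrow> a i = b (i - 1)"
  shows "totally_nonnegative (hurwitz_array a)"
proof -
  have "hurwitz_array a = (\<lambda>r s. (if odd r then c else 0) * hurwitz_array b r s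
      + 1 * hurwitz_array b (Suc r) s)"
  proof (intro ext)
    fix r s
    show "hurwitz_array a r s = (if odd r then c else 0) * hurwitz_array b r s
      + 1 * hurwitz_array b (Suc r) s"
    proof (cases "odd r")
      case True
      then have "even (2 * int s - int r - 1)" by simp
      from even[OF this] True show ?thesis
        by (simp add: hurwitz_array_def algebra_simps)
    next
      case False
      then have "odd (2 * int s - int r - 1)" by simp
      from odd[OF this] False show ?thesis
        by (simp add: hurwitz_array_def algebra_simps)
    qed
  qed
  with totally_nonnegative_bidiagonal[OF b, of "\<lambda>r. if odd r then c else 0" "\<lambda>_. 1"] c
  show ?thesis by simp
qed

section \<open>Real polynomials without zeros in the right half-plane\<close>

text \<open>Vieta's formula for the second coefficient; the other two conjuncts carry the induction.\<close>

lemma coeff_prod_linear_factors: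
  fixes M :: "complex multiset"
  shows "coeff (\<Prod>w\<in>#M. [:-w, 1:]) (size M) = 1 \<and> degree (\<Prod>w\<in>#M. [:-w, 1:]) \<le> size M \<and>
    (\<forall>m. size M = Suc m \<longrightarrow> coeff (\<Prod>w\<in>#M. [:-w, 1:]) m = - sum_mset M)"
proof (induction M)
  case empty
  then show ?case by simp
next
  case (add w M)
  let ?f = "\<Prod>w\<in>#M. [:-w, 1:]"
  have z: "coeff ?f (Suc (size M)) = 0"
    using add by (intro coeff_eq_0) auto
  have "degree ([:-w, 1:] * ?f) \<le> degree [:-w, 1:] + degree ?f"
    by (rule degree_mult_le)
  with add have deg: "degree ([:-w, 1:] * ?f) \<le> Suc (size M)" by simp
  show ?case
  proof (cases "size M")
    case 0
    then show ?thesis using add deg z by (auto simp: coeff_pCons)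
  next
    case (Suc m)
    then show ?thesis using add deg z by (auto simp: coeff_pCons)
  qed
qed

lemma cmod_reflection_le:
  fixes z w :: complex
  assumes "Re z > 0" "Re w \<le> 0"
  shows "cmod (- cnj z - w) \<le> cmod (z - w)"
proof -
  have "(Re z + Re w)\<^sup>2 \<le> (Re z - Re w)\<^sup>2"
    using assms by (simp add: power2_eq_square algebra_simps mult_nonpos_nonneg)
  also have "(Re z + Re w)\<^sup>2 = (- Re z - Re w)\<^sup>2" by (simp add: power2_eq_square algebra_simps)
  finally show ?thesis
    unfolding cmod_def by simp
qed

lemma cmod_reflection_less:
  fixes z w :: complex
  assumes "Re z > 0" "Re w < 0"
  shows "cmod (- cnj z - w) < cmod (z - w)"
proof -
  have "(Re z + Re w)\<^sup>2 < (Re z - Re w)\<^sup>2"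
    using assms by (simp add: power2_eq_square algebra_simps mult_neg_pos)
  also have "(Re z + Re w)\<^sup>2 = (- Re z - Re w)\<^sup>2" by (simp add: power2_eq_square algebra_simps)
  finally show ?thesis
    unfolding cmod_def by simp
qed

text \<open>The point \<open>- cnj z\<close> is the mirror image of \<open>z\<close> in the imaginary axis, hence not
  farther from any zero in the closed left half-plane.\<close>

lemma cmod_prod_reflection_le:
  fixes M :: "complex multiset"
  assumes "Re z > 0" "\<And>w. w \<in># M \<Longrightarrow> Re w \<le> 0"
  shows "cmod (poly (\<Prod>w\<in>#M. [:-w, 1:]) (- cnj z)) \<le> cmod (poly (\<Prod>w\<in>#M. [:-w, 1:]) z)"
  using assms(2)
proof (induction M)
  case (add w M)
  have "cmod (- cnj z - w) * cmod (poly (\<Prod>w\<in>#M. [:-w, 1:]) (- cnj z))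
      \<le> cmod (z - w) * cmod (poly (\<Prod>w\<in>#M. [:-w, 1:]) z)"
    using add cmod_reflection_le[OF assms(1), of w] by (intro mult_mono) auto
  then show ?case
    by (simp add: norm_mult[symmetric] algebra_simps)
qed simp

text \<open>The logarithmic derivative is the sum of the fractions \<open>1 / (z - w)\<close>, each of which
  has positive real part.\<close>

lemma Re_log_derivative_prod_nonneg:
  fixes M :: "complex multiset"
  assumes "Re z > 0" "\<And>w. w \<in># M \<Longrightarrow> Re w \<le> 0"
  shows "poly (\<Prod>w\<in>#M. [:-w, 1:]) z \<noteq> 0 \<and>
    Re (poly (pderiv (\<Prod>w\<in>#M. [:-w, 1:])) z / poly (\<Prod>w\<in>#M. [:-w, 1:]) z) \<ge> 0"
  using assms(2)
proof (induction M)
  case (add w M)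
  let ?f = "\<Prod>w\<in>#M. [:-w, 1:]"
  have IH: "poly ?f z \<noteq> 0" "Re (poly (pderiv ?f) z / poly ?f z) \<ge> 0"
    using add by auto
  have Rew: "Re w \<le> 0" using add by simp
  then have nz: "z - w \<noteq> 0" using assms(1) by auto
  have "poly (pderiv ([:-w, 1:] * ?f)) z / poly ([:-w, 1:] * ?f) z =
      1 / (z - w) + poly (pderiv ?f) z / poly ?f z"
    unfolding pderiv_mult using nz IH(1) by (simp add: pderiv_pCons divide_simps) (simp add: algebra_simps)
  moreover have "Re (1 / (z - w)) \<ge> 0"
    using Rew assms(1) by (simp add: Re_divide)
  moreover have "poly ([:-w, 1:] * ?f) z \<noteq> 0"
    using nz IH(1) by (simp add: algebra_simps)
  ultimately show ?case
    using IH(2) by (simp del: mult_pCons_left)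
qed simp

lemma quasi_stable_reflection_less:
  fixes f :: "complex poly"
  assumes f: "f \<noteq> 0" "quasi_stable f" and w: "poly f w = 0" "Re w < 0" and z: "Re z > 0"
  shows "cmod (poly f (- cnj z)) < cmod (poly f z)"
proof -
  have roots: "x \<in># proots f \<longleftrightarrow> poly f x = 0" for x
    using f(1) by simp
  then have stable: "Re x \<le> 0" if "x \<in># proots f" for x
    using f(2) that unfolding quasi_stable_def by blast
  obtain M where M: "proots f = add_mset w M"
    using roots w(1) by (metis mset_add)
  let ?g = "\<Prod>x\<in>#M. [:-x, 1:]"
  have fz: "poly f x = lead_coeff f * ((x - w) * poly ?g x)" for x
    using arg_cong[OF complex_poly_decompose_multiset[of f], of "\<lambda>h. poly h x"]
    by (simp add: M algebra_simps)
  have "poly f z \<noteq> 0"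
    using f(2) z unfolding quasi_stable_def by (meson not_less)
  then have "poly ?g z \<noteq> 0" by (auto simp: fz)
  have "cmod (- cnj z - w) * cmod (poly ?g (- cnj z)) \<le> cmod (- cnj z - w) * cmod (poly ?g z)"
    using stable M by (intro mult_left_mono cmod_prod_reflection_le[OF z]) auto
  also have "\<dots> < cmod (z - w) * cmod (poly ?g z)"
    using cmod_reflection_less[OF z w(2)] \<open>poly ?g z \<noteq> 0\<close> by simp
  finally show ?thesis
    using f(1) by (simp add: fz norm_mult)
qed

lemma second_coeff_eq_sum_roots:
  fixes f :: "complex poly"
  assumes "degree f = Suc m"
  shows "coeff f m = - lead_coeff f * sum_mset (proots f)"
proof -
  have "size (proots f) = Suc m"
    using assms by (simp add: size_proots_complex)
  then have "coeff (\<Prod>w\<in>#proots f. [:-w, 1:]) m = - sum_mset (proots f)"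
    using coeff_prod_linear_factors[of "proots f"] by simp
  moreover have "coeff f m = lead_coeff f * coeff (\<Prod>w\<in>#proots f. [:-w, 1:]) m"
    by (metis coeff_smult complex_poly_decompose_multiset)
  ultimately show ?thesis by (simp only: minus_mult_commute)
qed

lemma Re_sum_mset: "Re (sum_mset M) = (\<Sum>w\<in>#M. Re w)"
  by (induction M) auto

lemma map_poly_complex_of_real [simp]:
  "degree (map_poly complex_of_real p) = degree p"
  "map_poly complex_of_real p = 0 \<longleftrightarrow> p = 0"
  by (simp_all add: degree_map_poly map_poly_eq_0_iff)

lemma second_desc_coeff_eq_sum_roots:
  assumes "degree p = Suc m"
  shows "desc_coeff p 1 = - desc_coeff p 0 * (\<Sum>w\<in>#proots (map_poly complex_of_real p). Re w)"
proof -
  let ?f = "map_poly complex_of_real p"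
  have "coeff ?f m = - lead_coeff ?f * sum_mset (proots ?f)"
    using assms by (intro second_coeff_eq_sum_roots) simp
  then have "complex_of_real (desc_coeff p 1) =
      complex_of_real (- desc_coeff p 0) * sum_mset (proots ?f)"
    using assms by (simp only: map_poly_complex_of_real coeff_map_poly of_real_0 of_real_minus)
      (simp add: desc_coeff_def del: sum_mset_distrib_left)
  from arg_cong[OF this, of Re] show ?thesis
    by (simp only: Re_sum_mset[symmetric] times_complex.sel Re_complex_of_real
        Im_complex_of_real mult_zero_left diff_zero)
qed

lemma sum_mset_real_nonneg: "(\<And>x. x \<in># M \<Longrightarrow> g x \<ge> (0::real)) \<Longrightarrow> (\<Sum>x\<in>#M. g x) \<ge> 0"
  by (induction M) auto

lemma sum_mset_real_nonpos: "(\<And>x. x \<in># M \<Longrightarrow> g x \<le> (0::real)) \<Longrightarrow> (\<Sum>x\<in>#M. g x) \<le> 0"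
  by (induction M) (auto simp: add_nonpos_nonpos)

text \<open>The quotient \<open>(p + \<epsilon> p') / p\<close> is \<open>1 + \<epsilon> p' / p\<close>, whose real part is at least 1 in the right
  half-plane.\<close>

lemma quasi_stable_add_pderiv:
  fixes p :: "real poly"
  assumes stable: "quasi_stable (map_poly complex_of_real p)" and "p \<noteq> 0" "\<epsilon> > 0"
  shows "quasi_stable (map_poly complex_of_real (p + Polynomial.smult \<epsilon> (pderiv p)))"
proof -
  let ?f = "map_poly complex_of_real p"
  have f0: "?f \<noteq> 0" using assms(2) by simp
  have eq: "map_poly complex_of_real (p + Polynomial.smult \<epsilon> (pderiv p)) = ?f + Polynomial.smult (of_real \<epsilon>) (pderiv ?f)"
    by (rule poly_eqI) (simp add: coeff_map_poly coeff_pderiv)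
  have "poly (?f + Polynomial.smult (of_real \<epsilon>) (pderiv ?f)) z \<noteq> 0" if z: "Re z > 0" for z
  proof -
    let ?g = "\<Prod>w\<in>#proots ?f. [:-w, 1:]" and ?l = "lead_coeff ?f"
    have fac: "?f = Polynomial.smult ?l ?g"
      by (rule complex_poly_decompose_multiset[symmetric])
    have "Re w \<le> 0" if "w \<in># proots ?f" for w
      using that stable f0 by (simp add: quasi_stable_def)
    then have g: "poly ?g z \<noteq> 0" "Re (poly (pderiv ?g) z / poly ?g z) \<ge> 0"
      using Re_log_derivative_prod_nonneg[OF z, of "proots ?f"] by auto
    have "Re (1 + of_real \<epsilon> * (poly (pderiv ?g) z / poly ?g z)) =
        1 + \<epsilon> * Re (poly (pderiv ?g) z / poly ?g z)"
      by (simp only: plus_complex.sel one_complex.sel times_complex.sel Re_complex_of_real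
          Im_complex_of_real mult_zero_left diff_zero)
    also have "\<dots> > 0"
      using mult_nonneg_nonneg[OF less_imp_le[OF \<open>\<epsilon> > 0\<close>] g(2)] by linarith
    finally have "Re (1 + of_real \<epsilon> * (poly (pderiv ?g) z / poly ?g z)) > 0" .
    then have "1 + of_real \<epsilon> * (poly (pderiv ?g) z / poly ?g z) \<noteq> 0"
      by (metis less_irrefl zero_complex.sel(1))
    moreover have "poly (?f + Polynomial.smult (of_real \<epsilon>) (pderiv ?f)) z =
        ?l * poly ?g z * (1 + of_real \<epsilon> * (poly (pderiv ?g) z / poly ?g z))"
      using g(1) by (subst (1 2) fac) (simp add: pderiv_smult field_simps)
    moreover have "?l \<noteq> 0" using f0 by (simp only: leading_coeff_0_iff not_False_eq_True)
    ultimately show ?thesis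
      using g(1) by (metis mult_eq_0_iff)
  qed
  then show ?thesis
    unfolding quasi_stable_def eq by (meson not_less)
qed

lemma quasi_stable_imp_second_desc_coeff_nonneg:
  assumes n: "degree p = Suc m" and a: "desc_coeff p 0 > 0"
    and stable: "quasi_stable (map_poly complex_of_real p)"
  shows "desc_coeff p 1 \<ge> 0"
proof -
  let ?f = "map_poly complex_of_real p"
  have "p \<noteq> 0" using n by auto
  then have "Re w \<le> 0" if "w \<in># proots ?f" for w
    using that stable by (simp add: quasi_stable_def)
  then have "(\<Sum>w\<in>#proots ?f. Re w) \<le> 0"
    by (intro sum_mset_real_nonpos) auto
  then show ?thesis
    unfolding second_desc_coeff_eq_sum_roots[OF n]
    using a by (intro mult_nonpos_nonpos) auto
qed

section \<open>The Routh step preserves quasi-stability\<close>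

text \<open>The Cayley transform \<open>x \<mapsto> (1 + x) / (1 - x)\<close> takes the unit disc to the right
  half-plane.\<close>

lemma Re_cayley_nonneg:
  fixes u v :: complex
  assumes "cmod v < cmod u"
  shows "Re ((u + v) / (u - v)) \<ge> 0"
proof -
  have "(cmod v)\<^sup>2 \<le> (cmod u)\<^sup>2"
    using assms by (intro power_mono) auto
  then have "Re ((u + v) * cnj (u - v)) \<ge> 0"
    unfolding cmod_power2 by (simp add: power2_eq_square algebra_simps)
  then show ?thesis
    by (subst complex_div_cnj) (simp add: Re_divide_of_real flip: of_real_power)
qed

text \<open>Rather than boundary values on the imaginary axis, the hypotheses use a
  lower bound that tends to \<open>l\<close> there; the principle is applied on the half-disc cut off by a
  line \<open>Re z = \<delta>\<close>, up to an error \<open>\<eta>\<close>.\<close>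

lemma half_plane_minimum_principle:
  fixes h :: "complex \<Rightarrow> complex"
  assumes hol: "h holomorphic_on {z. Re z > 0}"
    and bd: "\<And>z. Re z > 0 \<Longrightarrow> Re (h z) \<ge> l - c * Re z"
    and lim: "(h \<longlongrightarrow> of_real l) at_infinity"
    and c: "c > 0" and z0: "Re z0 > 0"
  shows "Re (h z0) \<ge> l"
proof (rule field_le_epsilon)
  fix \<eta> :: real assume "\<eta> > 0"
  have "eventually (\<lambda>z. dist (h z) (of_real l) < \<eta>) at_infinity"
    using lim \<open>\<eta> > 0\<close> by (rule tendstoD)
  then obtain R0 where R0: "\<And>z. cmod z \<ge> R0 \<Longrightarrow> dist (h z) (of_real l) < \<eta>"
    unfolding eventually_at_infinity by blast
  define R where "R = max R0 (cmod z0)"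
  define \<delta> where "\<delta> = min (Re z0) (\<eta> / c)"
  have \<delta>: "\<delta> > 0" "\<delta> \<le> Re z0" "c * \<delta> \<le> \<eta>"
    using z0 c \<open>\<eta> > 0\<close> by (auto simp: \<delta>_def min_def field_simps)
  define S where "S = {z. \<delta> \<le> Re z} \<inter> cball 0 R"
  have sub: "S \<subseteq> {z. Re z > 0}"
    using \<delta> by (auto simp: S_def)
  have closed: "closed S"
    unfolding S_def by (intro closed_Int closed_halfspace_Re_ge closed_cball)
  have open_part: "open ({z. \<delta> < Re z} \<inter> ball 0 R)"
    by (intro open_Int open_halfspace_Re_gt open_ball)
  have "{z. \<delta> < Re z} \<inter> ball 0 R \<subseteq> interior S"
    by (rule interior_maximal[OF _ open_part]) (auto simp: S_def)
  then have front: "Re z = \<delta> \<or> cmod z = R" "z \<in> S" if "z \<in> frontier S" for z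
  proof -
    show "z \<in> S" using that closed by (simp add: frontier_def)
    moreover have "z \<notin> {z. \<delta> < Re z} \<inter> ball 0 R"
      using that \<open>_ \<subseteq> interior S\<close> by (auto simp: frontier_def)
    ultimately show "Re z = \<delta> \<or> cmod z = R"
      by (auto simp: S_def)
  qed
  have "Re (- h z0) \<le> - l + \<eta>"
  proof (rule maximum_real_frontier[of "\<lambda>z. - h z" S])
    show "(\<lambda>z. - h z) holomorphic_on interior S"
      using holomorphic_on_subset[OF hol order_trans[OF interior_subset sub]]
      by (intro holomorphic_intros)
    show "continuous_on (closure S) (\<lambda>z. - h z)"
      using holomorphic_on_imp_continuous_on[OF holomorphic_on_subset[OF hol sub]] closed
      by (intro continuous_intros) simp
    show "bounded S"
      unfolding S_def by (intro bounded_Int) auto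
    show "z0 \<in> S"
      using \<delta> by (auto simp: S_def R_def)
    show "Re (- h z) \<le> - l + \<eta>" if z: "z \<in> frontier S" for z
    proof (cases "Re z = \<delta>")
      case True
      then show ?thesis using bd[of z] \<delta> by simp
    next
      case False
      then have "dist (h z) (of_real l) < \<eta>"
        using front[OF z] by (intro R0) (auto simp: R_def)
      then have "\<bar>Re (h z - of_real l)\<bar> < \<eta>"
        using abs_Re_le_cmod[of "h z - of_real l"] by (simp add: dist_norm)
      then show ?thesis by simp
    qed
  qed
  then show "l \<le> Re (h z0) + \<eta>" by simp
qed

text \<open>The terms of \<open>p\<close> whose exponent differs in parity from the degree; they carry the
  coefficients in the even rows of the Hurwitz array.\<close>

definition opposite_parity_part :: "real poly \<Rightarrow> real poly" where
  "opposite_parity_part p =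
     Polynomial.smult (1 / 2) (p - Polynomial.smult ((-1) ^ degree p) (p \<circ>\<^sub>p [:0, -1:]))"

text \<open>One division step of the Euclidean algorithm applied to the two parity parts of \<open>p\<close>,
  with the remainder and the divisor added up to a polynomial again.\<close>

definition routh_step :: "real poly \<Rightarrow> real poly" where
  "routh_step p = p - Polynomial.smult (desc_coeff p 0 / desc_coeff p 1) (pCons 0 (opposite_parity_part p))"

lemma coeff_opposite_parity_part:
  "coeff (opposite_parity_part p) k = (if even (degree p + k) then 0 else coeff p k)"
  by (auto simp: opposite_parity_part_def coeff_pcompose_linear mult.assoc[symmetric] simp flip: power_add)

lemma
  assumes n: "degree p = Suc m" and a1: "desc_coeff p 1 \<noteq> 0"
  shows coeff_routh_step: "coeff (routh_step p) k =
      coeff p k - (if k = 0 \<or> even (m + k) then 0 else desc_coeff p 0 / desc_coeff p 1 * coeff p (k - 1))"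
    and degree_opposite_parity_part: "degree (opposite_parity_part p) = m"
    and lead_opposite_parity_part: "coeff (opposite_parity_part p) m = desc_coeff p 1"
    and degree_routh_step: "degree (routh_step p) = m"
    and lead_routh_step: "coeff (routh_step p) m = desc_coeff p 1"
proof -
  show ck: "coeff (routh_step p) k =
      coeff p k - (if k = 0 \<or> even (m + k) then 0 else desc_coeff p 0 / desc_coeff p 1 * coeff p (k - 1))"
    for k
    using n by (cases k) (auto simp: routh_step_def coeff_opposite_parity_part coeff_pCons)
  have a: "desc_coeff p 1 = coeff p m" "desc_coeff p 0 = coeff p (Suc m)"
    using n by (simp_all add: desc_coeff_def)
  show c: "coeff (opposite_parity_part p) m = desc_coeff p 1"
    using n by (simp add: coeff_opposite_parity_part a)
  show "degree (opposite_parity_part p) = m"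
  proof (rule antisym)
    show "degree (opposite_parity_part p) \<le> m"
    proof (rule degree_le, intro allI impI)
      fix k assume "m < k"
      then show "coeff (opposite_parity_part p) k = 0"
        using n by (cases "k = Suc m") (auto simp: coeff_opposite_parity_part coeff_eq_0)
    qed
  qed (use c a1 in \<open>simp add: le_degree\<close>)
  show c: "coeff (routh_step p) m = desc_coeff p 1"
    by (simp add: ck a)
  show "degree (routh_step p) = m"
  proof (rule antisym)
    show "degree (routh_step p) \<le> m"
    proof (rule degree_le, intro allI impI)
      fix k assume "m < k"
      then show "coeff (routh_step p) k = 0"
      proof (cases "k = Suc m")
        case True
        then show ?thesis using a1 by (simp add: ck a)
      next
        case False
        with \<open>m < k\<close> have k: "Suc m < k" by simp
        then have "k \<noteq> Suc (Suc m)" if "odd (m + k)" using that by auto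
        with k have "Suc m < k - 1" if "odd (m + k)" using that by linarith
        then have "coeff p (k - 1) = 0" if "odd (m + k)"
          using that n by (intro coeff_eq_0) simp
        moreover have "coeff p k = 0" using k n by (intro coeff_eq_0) simp
        ultimately show ?thesis by (auto simp: ck)
      qed
    qed
  qed (use c a1 in \<open>simp add: le_degree\<close>)
qed

lemma desc_coeff_routh_step:
  assumes n: "degree p = Suc m" and a1: "desc_coeff p 1 \<noteq> 0"
  defines "c \<equiv> desc_coeff p 0 / desc_coeff p 1"
  shows "even i \<Longrightarrow> desc_coeff p i = c * desc_coeff (routh_step p) i + desc_coeff (routh_step p) (i - 1)"
    and "odd i \<Longrightarrow> desc_coeff p i = desc_coeff (routh_step p) (i - 1)"
proof -
  have step: "desc_coeff (routh_step p) j =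
      (if even j then desc_coeff p (j + 1) else desc_coeff p (j + 1) - c * desc_coeff p (j + 2))" for j
  proof -
    consider "j < -2" | "j = -2" | "j = -1" | l where "j = int l" "l \<le> m" | l where "j = int l" "m < l"
    proof (cases "j \<ge> 0")
      case True
      then show ?thesis using that(4,5)[of "nat j"] by linarith
    next
      case False
      then show ?thesis using that(1-3) by linarith
    qed
    then show ?thesis
    proof cases
      case 1
      then show ?thesis by (auto simp: desc_coeff_def)
    next
      case 2
      then show ?thesis by (simp add: desc_coeff_def)
    next
      case 3
      then show ?thesis using a1 by (simp add: c_def) (simp add: desc_coeff_def)
    next
      case (4 l)
      have "desc_coeff (routh_step p) j = coeff (routh_step p) (m - l)"
        using 4 degree_routh_step[OF n a1] by (simp add: desc_coeff_def)
      also have "\<dots> = coeff p (m - l) -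
          (if l = m \<or> even l then 0 else c * coeff p (m - l - 1))"
        using 4 by (auto simp: coeff_routh_step[OF n a1] c_def)
      also have "coeff p (m - l) = desc_coeff p (j + 1)"
        using 4 n by (simp add: desc_coeff_def nat_add_distrib)
      also have "(if l = m \<or> even l then 0 else c * coeff p (m - l - 1)) =
          (if even l then 0 else c * desc_coeff p (j + 2))"
        using 4 n by (auto simp: desc_coeff_def nat_add_distrib)
      finally show ?thesis using 4 by simp
    next
      case (5 l)
      then show ?thesis
        using degree_routh_step[OF n a1] n by (simp add: desc_coeff_def)
    qed
  qed
  show "even i \<Longrightarrow> desc_coeff p i = c * desc_coeff (routh_step p) i + desc_coeff (routh_step p) (i - 1)"
    by (simp add: step algebra_simps)
  show "odd i \<Longrightarrow> desc_coeff p i = desc_coeff (routh_step p) (i - 1)"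
    by (simp add: step algebra_simps)
qed

lemma complex_opposite_parity_part:
  "poly (map_poly complex_of_real (opposite_parity_part p)) z =
    (poly (map_poly complex_of_real p) z - (-1) ^ degree p * poly (map_poly complex_of_real p) (- z)) / 2"
proof -
  let ?f = "map_poly complex_of_real p"
  have "map_poly complex_of_real (opposite_parity_part p) =
      Polynomial.smult (1 / 2) (?f - Polynomial.smult ((-1) ^ degree p) (?f \<circ>\<^sub>p [:0, -1:]))"
    by (rule poly_eqI) (simp add: opposite_parity_part_def coeff_map_poly coeff_pcompose_linear)
  then show ?thesis by (simp add: poly_pcompose)
qed

lemma complex_routh_step:
  "poly (map_poly complex_of_real (routh_step p)) z = poly (map_poly complex_of_real p) z -
    complex_of_real (desc_coeff p 0 / desc_coeff p 1) * (z * poly (map_poly complex_of_real (opposite_parity_part p)) z)"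
proof -
  have "map_poly complex_of_real (routh_step p) = map_poly complex_of_real p -
    Polynomial.smult (complex_of_real (desc_coeff p 0 / desc_coeff p 1)) (pCons 0 (map_poly complex_of_real (opposite_parity_part p)))"
    by (rule poly_eqI) (simp add: routh_step_def coeff_map_poly coeff_pCons split: nat.splits)
  then show ?thesis by simp
qed

text \<open>The quotient of \<open>routh_step p\<close> by the opposite parity part has real part at least 1,
  by the minimum principle. That the second coefficient is positive is needed twice: for the
  division, and because it provides a zero of \<open>p\<close> strictly to the left of the imaginary axis, so that the
  reflection inequality is strict.\<close>

lemma quasi_stable_routh_step:
  assumes n: "degree p = Suc m" and a: "desc_coeff p 0 > 0" "desc_coeff p 1 > 0"
    and stable: "quasi_stable (map_poly complex_of_real p)"
  shows "quasi_stable (map_poly complex_of_real (routh_step p))"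
proof -
  define f where "f = map_poly complex_of_real p"
  define g where "g = map_poly complex_of_real (opposite_parity_part p)"
  define q where "q = map_poly complex_of_real (routh_step p)"
  define c where "c = desc_coeff p 0 / desc_coeff p 1"
  have c: "c > 0" using a by (simp add: c_def)
  have a1: "desc_coeff p 1 \<noteq> 0" using a by simp
  have f0: "f \<noteq> 0" using n by (auto simp: f_def)
  have degf: "degree f = Suc m" using n by (simp add: f_def)
  have cnj: "poly f (cnj z) = cnj (poly f z)" for z
    by (subst poly_cnj_real) (auto simp: f_def coeff_map_poly)
  obtain w where w: "poly f w = 0" "Re w < 0"
  proof -
    have "\<exists>w. w \<in># proots f \<and> Re w < 0"
    proof (rule ccontr)
      assume "\<not> ?thesis"
      then have "(\<Sum>w\<in>#proots f. Re w) \<ge> 0"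
        by (intro sum_mset_real_nonneg) (auto simp: not_less)
      then have "- desc_coeff p 0 * (\<Sum>w\<in>#proots f. Re w) \<le> 0"
        using a by (intro mult_nonpos_nonneg) auto
      with a second_desc_coeff_eq_sum_roots[OF n] show False
        by (simp only: f_def)
    qed
    then obtain w where "w \<in># proots f" "Re w < 0" by blast
    with f0 that show ?thesis by auto
  qed
  have refl: "cmod (poly f (- z)) < cmod (poly f z)" if "Re z > 0" for z
  proof -
    have "poly f (- cnj z) = cnj (poly f (- z))"
      using cnj[of "- z"] by simp
    then show ?thesis
      using quasi_stable_reflection_less[OF f0 _ w that] stable by (simp add: f_def)
  qed
  have gz: "poly g z = (poly f z - (-1) ^ Suc m * poly f (- z)) / 2" for z
    using complex_opposite_parity_part[of p z] n by (simp add: g_def f_def)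
  have qz: "poly q z = poly f z - of_real c * (z * poly g z)" for z
    using complex_routh_step[of p z] by (simp add: q_def g_def f_def c_def)
  have g_nz: "poly g z \<noteq> 0" if "Re z > 0" for z
  proof
    assume "poly g z = 0"
    then have "poly f z = (-1) ^ Suc m * poly f (- z)" by (simp add: gz eq_neg_iff_add_eq_0)
    then have "cmod (poly f z) = cmod (poly f (- z))" 
      by (metis norm_mult norm_power norm_minus_cancel norm_one power_one mult_1)
    with refl[OF that] show False by simp
  qed
  have quot: "poly q z / poly g z =
      1 + (poly f z + (-1) ^ Suc m * poly f (- z)) / (poly f z - (-1) ^ Suc m * poly f (- z)) - of_real c * z"
    if "Re z > 0" for z
  proof -
    let ?u = "poly f z" and ?v = "(-1) ^ Suc m * poly f (- z)"
    have "?u - ?v \<noteq> 0" using g_nz[OF that] by (simp add: gz)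
    then have "?u / ((?u - ?v) / 2) = 1 + (?u + ?v) / (?u - ?v)"
      by (simp add: field_simps)
    moreover have "poly q z / poly g z = ?u / poly g z - of_real c * z"
      using g_nz[OF that] by (simp add: qz field_simps)
    ultimately show ?thesis by (simp add: gz)
  qed
  have "Re (poly q z / poly g z) \<ge> 1" if "Re z > 0" for z
  proof (rule half_plane_minimum_principle[OF _ _ _ c that])
    show "(\<lambda>z. poly q z / poly g z) holomorphic_on {z. Re z > 0}"
      using g_nz by (intro holomorphic_intros) auto
    show "Re (poly q z / poly g z) \<ge> 1 - c * Re z" if "Re z > 0" for z
    proof -
      have "cmod ((-1) ^ Suc m * poly f (- z)) < cmod (poly f z)"
        using refl[OF that] by (simp add: norm_mult norm_power)
      from Re_cayley_nonneg[OF this] show ?thesis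
        unfolding quot[OF that] by simp
    qed
    show "((\<lambda>z. poly q z / poly g z) \<longlongrightarrow> complex_of_real 1) at_infinity"
    proof -
      have "degree g = m" "lead_coeff g = of_real (desc_coeff p 1)"
        using degree_opposite_parity_part[OF n a1] lead_opposite_parity_part[OF n a1]
        by (simp_all add: g_def coeff_map_poly)
      moreover have "degree q = m" "lead_coeff q = of_real (desc_coeff p 1)"
        using degree_routh_step[OF n a1] lead_routh_step[OF n a1]
        by (simp_all add: q_def coeff_map_poly)
      ultimately have "((\<lambda>z. (poly q z / z ^ m) / (poly g z / z ^ m)) \<longlongrightarrow>
          of_real (desc_coeff p 1) / of_real (desc_coeff p 1)) at_infinity"
        using poly_divide_tendsto_aux[of q] poly_divide_tendsto_aux[of g] a1
        by (intro tendsto_divide) auto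
      moreover have "eventually (\<lambda>z::complex. (poly q z / z ^ m) / (poly g z / z ^ m) = poly q z / poly g z) at_infinity"
        by (rule eventually_at_infinityI[of 1]) auto
      ultimately show ?thesis
        using a1 by (subst (asm) tendsto_cong) auto
    qed
  qed
  then have "poly q z \<noteq> 0" if "Re z > 0" for z
    using that by fastforce
  then show ?thesis
    unfolding quasi_stable_def q_def[symmetric] by (meson not_less)
qed

section \<open>Quasi-stability implies total nonnegativity\<close>

text \<open>Induction on the degree by Routh steps. A vanishing second coefficient, which
  occurs when all zeros are purely imaginary, is made positive by adding \<open>\<epsilon> p'\<close>.\<close>

theorem quasi_stable_imp_tnn:
  assumes "desc_coeff p 0 > 0" and "quasi_stable (map_poly complex_of_real p)"
  shows "totally_nonnegative (hurwitz_array (desc_coeff p))"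
  using assms
proof (induction "degree p" arbitrary: p)
  case 0
  then show ?case
    by (intro hurwitz_array_monomial_tnn) (auto simp: desc_coeff_def)
next
  case (Suc m)
  have regular: "totally_nonnegative (hurwitz_array (desc_coeff r))"
    if r: "degree r = Suc m" "desc_coeff r 0 > 0" "desc_coeff r 1 > 0"
      "quasi_stable (map_poly complex_of_real r)" for r
  proof -
    have r1: "desc_coeff r 1 \<noteq> 0" using r by simp
    have "totally_nonnegative (hurwitz_array (desc_coeff (routh_step r)))"
    proof (rule Suc.hyps(1))
      show "m = degree (routh_step r)"
        using degree_routh_step[OF r(1) r1] by simp
      then show "desc_coeff (routh_step r) 0 > 0"
        using lead_routh_step[OF r(1) r1] r(3) by (simp add: desc_coeff_def)
      show "quasi_stable (map_poly complex_of_real (routh_step r))"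
        by (rule quasi_stable_routh_step[OF r])
    qed
    then show ?thesis
    proof (rule hurwitz_array_routh_step)
      show "desc_coeff r 0 / desc_coeff r 1 \<ge> 0" using r by simp
    qed (fact desc_coeff_routh_step[OF r(1) r1])+
  qed
  define d where "d i = (if 0 \<le> i \<and> i \<le> int (Suc m) then coeff (pderiv p) (Suc m - nat i) else 0)"
    for i
  have "totally_nonnegative (\<lambda>r s. hurwitz_array (desc_coeff p) r s + \<epsilon> * hurwitz_array d r s)"
    if "\<epsilon> > 0" for \<epsilon>
  proof -
    let ?r = "p + Polynomial.smult \<epsilon> (pderiv p)"
    have deg: "degree ?r = Suc m"
      using Suc.hyps(2) by (subst degree_add_eq_left) (auto simp: degree_pderiv intro: le_less_trans[OF degree_smult_le])
    have dc: "desc_coeff ?r i = desc_coeff p i + \<epsilon> * d i" for i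
      unfolding desc_coeff_def deg using Suc.hyps(2) by (simp add: d_def)
    have "totally_nonnegative (hurwitz_array (desc_coeff ?r))"
    proof (rule regular[OF deg])
      show "desc_coeff ?r 0 > 0"
        using Suc.prems(1) Suc.hyps(2) by (simp add: dc d_def coeff_pderiv coeff_eq_0)
      have "d 1 = real (Suc m) * desc_coeff p 0"
        using Suc.hyps(2) by (simp add: d_def coeff_pderiv desc_coeff_def)
      then have "\<epsilon> * d 1 > 0"
        using Suc.prems(1) that by simp
      then show "desc_coeff ?r 1 > 0"
        using quasi_stable_imp_second_desc_coeff_nonneg[OF Suc.hyps(2)[symmetric] Suc.prems]
        by (simp add: dc)
      show "quasi_stable (map_poly complex_of_real ?r)"
        using Suc.prems Suc.hyps(2) that by (intro quasi_stable_add_pderiv) auto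
    qed
    moreover have "hurwitz_array (desc_coeff ?r) =
        (\<lambda>r s. hurwitz_array (desc_coeff p) r s + \<epsilon> * hurwitz_array d r s)"
      by (simp add: hurwitz_array_def dc fun_eq_iff)
    ultimately show ?thesis by simp
  qed
  then show ?case by (rule totally_nonnegative_limit)
qed

section \<open>Total nonnegativity implies quasi-stability\<close>

text \<open>On descending coefficients this is multiplication of the polynomial by \<open>z + 1\<close>. On
  Hurwitz arrays it adds to each row the row below it.\<close>

definition shift_add :: "(int \<Rightarrow> real) \<Rightarrow> int \<Rightarrow> real" where
  "shift_add a i = a i + a (i - 1)"

lemma hurwitz_array_shift_add:
  "hurwitz_array (shift_add a) = (\<lambda>r s. 1 * hurwitz_array a r s + 1 * hurwitz_array a (Suc r) s)"
  by (simp add: fun_eq_iff hurwitz_array_def shift_add_def algebra_simps)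

lemma totally_nonnegative_shift_add:
  assumes "totally_nonnegative (hurwitz_array a)"
  shows "totally_nonnegative (hurwitz_array ((shift_add ^^ K) a))"
  using assms
proof (induction K)
  case (Suc K)
  have "totally_nonnegative (hurwitz_array (shift_add ((shift_add ^^ K) a)))"
    unfolding hurwitz_array_shift_add
    by (rule totally_nonnegative_bidiagonal) (use Suc in auto)
  then show ?case by simp
qed simp

lemma shift_add_support:
  assumes "\<And>i. i < 0 \<or> i > int n \<Longrightarrow> a i = 0" and "i < 0 \<or> i > int (n + K)"
  shows "(shift_add ^^ K) a i = 0"
  using assms(2)
proof (induction K arbitrary: i)
  case 0
  then show ?case using assms(1) by auto
next
  case (Suc K)
  then have "(shift_add ^^ K) a i = 0" "(shift_add ^^ K) a (i - 1) = 0" by auto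
  then show ?case by (simp add: shift_add_def[of "(shift_add ^^ K) a"])
qed

lemma shift_add_root:
  fixes w :: complex
  assumes supp: "\<And>i. i < 0 \<or> i > int n \<Longrightarrow> a i = 0"
    and root: "(\<Sum>i\<le>n. of_real (a (int i)) * w ^ i) = 0"
  shows "(\<Sum>i\<le>n + K. of_real ((shift_add ^^ K) a (int i)) * w ^ i) = 0"
proof (induction K)
  case 0
  then show ?case using root by simp
next
  case (Suc K)
  let ?b = "(shift_add ^^ K) a"
  have b: "?b i = 0" if "i < 0 \<or> i > int (n + K)" for i
    by (rule shift_add_support[OF supp that])
  have "(\<Sum>i\<le>Suc (n + K). of_real (?b (int i)) * w ^ i) = 0"
    using Suc b[of "int (Suc (n + K))"] by simp
  moreover have "(\<Sum>i\<le>Suc (n + K). of_real (?b (int i - 1)) * w ^ i) = 0"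
  proof -
    have "(\<Sum>i\<le>Suc (n + K). of_real (?b (int i - 1)) * w ^ i) =
        w * (\<Sum>i\<le>n + K. of_real (?b (int i)) * w ^ i)"
      unfolding sum.atMost_Suc_shift sum_distrib_left using b[of "-1"] by (simp add: mult_ac)
    then show ?thesis using Suc by simp
  qed
  ultimately have "(\<Sum>i\<le>Suc (n + K). of_real (?b (int i) + ?b (int i - 1)) * w ^ i) = 0"
    by (simp only: of_real_add distrib_right sum.distrib add_0)
  then show ?case
    by (simp only: add_Suc_right funpow.simps comp_apply shift_add_def[of ?b])
qed

text \<open>Column \<open>s\<close> of the array of \<open>a\<close> has the nonzero entries \<open>a 0\<close> in row \<open>2 s - 1\<close> and
  \<open>a n\<close> in row \<open>2 s - 1 - n\<close>, at the two ends of its support. A selection that follows the upper end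
  in the first \<open>j\<close> columns and the lower end afterwards gives a minor that is the product of its
  diagonal. Each multiplication by \<open>z + 1\<close> lets every selected row lie one step higher: the
  rows that use this freedom are moved back down, which costs nothing since at least
  one term in the expansion of the minor is positive by induction.\<close>

lemma shift_add_minor_pos:
  assumes tnn: "totally_nonnegative (hurwitz_array a)"
    and supp: "\<And>i. i < 0 \<or> i > int n \<Longrightarrow> a i = 0" and pos: "a 0 > 0" "a (int n) > 0"
    and cs: "strict_mono_on {..<k} cs" "cs ` {..<k} \<subseteq> {1..}"
    and rs: "strict_mono_on {..<k} rs" "rs ` {..<k} \<subseteq> {1..}"
    and low: "\<And>i. i < j \<Longrightarrow> i < k \<Longrightarrow> rs i + 1 + n \<le> 2 * cs i \<and> 2 * cs i \<le> rs i + 1 + n + K"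
    and high: "\<And>i. j \<le> i \<Longrightarrow> i < k \<Longrightarrow> rs i + 1 \<le> 2 * cs i \<and> 2 * cs i \<le> rs i + 1 + K"
  shows "minor (hurwitz_array ((shift_add ^^ K) a)) k rs cs > 0"
  using rs low high
proof (induction K arbitrary: rs)
  case 0
  have mono: "cs i < cs l" if "i < l" "l < k" for i l
    using cs(1) that unfolding strict_mono_on_def by auto
  have ent: "hurwitz_array a (rs i) (cs l) =
      (if i < j then a (2 * int (cs l) - 2 * int (cs i) + int n) else a (2 * int (cs l) - 2 * int (cs i)))"
    if "i < k" for i l
  proof (cases "i < j")
    case True
    then have "2 * cs i = rs i + 1 + n" using 0(3)[of i] that by auto
    then have "2 * int (cs l) - int (rs i) - 1 = 2 * int (cs l) - 2 * int (cs i) + int n" by linarith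
    then show ?thesis unfolding hurwitz_array_def using True by presburger
  next
    case False
    then have "2 * cs i = rs i + 1" using 0(4)[of i] that by auto
    then have "2 * int (cs l) - int (rs i) - 1 = 2 * int (cs l) - 2 * int (cs i)" by linarith
    then show ?thesis unfolding hurwitz_array_def using False by presburger
  qed
  have "minor (hurwitz_array a) k rs cs = (\<Prod>i<k. hurwitz_array a (rs i) (cs i))"
  proof (rule det_eq_prod_diagonal)
    show "hurwitz_array a (rs i) (cs l) = 0" if "i < j" "i < l" "l < k" for i l
      using that mono[of i l] by (subst ent) (auto intro!: supp)
    show "hurwitz_array a (rs i) (cs l) = 0" if "j \<le> i" "i < k" "l < i" for i l
      using that mono[of l i] by (subst ent) (auto intro!: supp)
  qed
  also have "\<dots> > 0"
    using pos by (intro prod_pos) (auto simp: ent)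
  finally show ?case by simp
next
  case (Suc K)
  \<comment> \<open>Only rows that lie outside the range allowed for \<open>K\<close> are moved. Such a row never
    collides with the next one, because the column positions grow by two.\<close>
  define \<delta> where "\<delta> i \<longleftrightarrow> 2 * cs i = rs i + 2 + (if i < j then n else 0) + K" for i
  let ?rs = "\<lambda>i. rs i + of_bool (\<delta> i)"
  have "0 < minor (hurwitz_array ((shift_add ^^ K) a)) k ?rs cs"
  proof (rule Suc.IH)
    show "strict_mono_on {..<k} ?rs"
    proof (rule strict_mono_onI)
      fix i l assume il: "i \<in> {..<k}" "l \<in> {..<k}" "i < l"
      then have "rs i < rs l" "cs i < cs l"
        using cs(1) Suc.prems(1) unfolding strict_mono_on_def by auto
      moreover have "2 * cs l \<le> rs l + 2 + (if l < j then n else 0) + K"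
        using il Suc.prems(3,4)[of l] by (cases "l < j") auto
      ultimately show "?rs i < ?rs l"
        using il(3) by (auto simp: \<delta>_def split: if_splits)
    qed
    show "?rs ` {..<k} \<subseteq> {1..}" using Suc.prems(2) by force
    show "?rs i + 1 + n \<le> 2 * cs i \<and> 2 * cs i \<le> ?rs i + 1 + n + K" if "i < j" "i < k" for i
      using Suc.prems(3)[of i] that by (auto simp: \<delta>_def of_bool_def)
    show "?rs i + 1 \<le> 2 * cs i \<and> 2 * cs i \<le> ?rs i + 1 + K" if "j \<le> i" "i < k" for i
      using Suc.prems(4)[of i] that by (auto simp: \<delta>_def of_bool_def)
  qed
  also have "\<dots> \<le> minor (hurwitz_array (shift_add ((shift_add ^^ K) a))) k rs cs"
    unfolding hurwitz_array_shift_add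
    using minor_bidiagonal_ge[OF totally_nonnegative_shift_add[OF tnn, of K] _ _ Suc.prems(1,2) cs,
        of "\<lambda>_. 1" "\<lambda>_. 1" \<delta>] by simp
  finally show ?case by simp
qed

text \<open>The condition on \<open>s\<close> says that the support of column \<open>s\<close> lies inside the window
  of rows, so the sum is \<open>z ^ (2 s - 1)\<close> times the vanishing polynomial value.\<close>

lemma hurwitz_array_left_kernel:
  fixes z :: complex
  assumes supp: "\<And>i. i < 0 \<or> i > int N \<Longrightarrow> b i = 0"
    and root: "(\<Sum>i\<le>N. of_real (b (int i)) * (1 / z) ^ i) = 0" and z: "z \<noteq> 0"
    and s: "N + 2 \<le> 2 * s" "2 * s \<le> R"
  shows "(\<Sum>r\<in>{1..<R}. Im (z ^ r) * hurwitz_array b r s) = 0"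
proof -
  have "(\<Sum>r\<in>{1..<R}. z ^ r * of_real (hurwitz_array b r s)) =
      (\<Sum>r\<in>{2 * s - 1 - N..2 * s - 1}. z ^ r * of_real (hurwitz_array b r s))"
    using s by (intro sum.mono_neutral_right) (auto simp: hurwitz_array_def intro!: supp)
  also have "\<dots> = (\<Sum>i\<le>N. z ^ (2 * s - 1) * (of_real (b (int i)) * (1 / z) ^ i))"
  proof (rule sum.reindex_bij_witness[of _ "\<lambda>i. 2 * s - 1 - i" "\<lambda>r. 2 * s - 1 - r"])
    fix r assume r: "r \<in> {2 * s - 1 - N..2 * s - 1}"
    then have "r + (2 * s - 1 - r) = 2 * s - 1" using s by auto
    then have "z ^ (2 * s - 1) = z ^ r * z ^ (2 * s - 1 - r)"
      by (metis power_add)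
    moreover have "2 * int s - int r - 1 = int (2 * s - 1 - r)"
      using r s by auto
    ultimately show "z ^ (2 * s - 1) * (of_real (b (int (2 * s - 1 - r))) * (1 / z) ^ (2 * s - 1 - r)) =
        z ^ r * of_real (hurwitz_array b r s)"
      using z by (simp add: hurwitz_array_def power_divide)
  qed (use s in auto)
  also have "\<dots> = 0"
    by (simp only: sum_distrib_left[symmetric] root mult_zero_right)
  finally have "Im (\<Sum>r\<in>{1..<R}. z ^ r * of_real (hurwitz_array b r s)) = 0" by simp
  then show ?thesis by (simp add: Im_sum)
qed

lemma group_of_index:
  fixes u :: "nat \<Rightarrow> nat"
  assumes "u 0 \<le> r" "r < u G"
  shows "\<exists>i<G. u i \<le> r \<and> r < u (Suc i)"
  using assms
proof (induction G)
  case (Suc G)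
  then show ?case by (cases "r < u G") (auto simp: less_Suc_eq)
qed simp

text \<open>The window of rows is \<open>{1..<u G}\<close>, cut at \<open>u 0, \<dots>, u G\<close> into the sign runs of
  \<open>y r = Im (z ^ r)\<close>, where \<open>u i\<close> is the first row with \<open>r \<theta> > i pi\<close>. In each run the first row is the
  representative, since \<open>y\<close> does not vanish there. The columns \<open>c i\<close> are consecutive
  from the first one supported in the window, until the row \<open>u i\<close> would drop below the
  lower end \<open>2 c i - 1\<close> of the support; from then on \<open>c i\<close> follows \<open>u i\<close>. As \<open>u i\<close> grows by at least two and
  \<open>2 c i\<close> by exactly two in the first phase, the distance between them shrinks
  monotonically, passing from near the upper end of the support to near the
  lower end, which is the pattern that \<open>shift_add_minor_pos\<close> accepts.\<close>

lemma tnn_no_root_in_right_half_plane: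
  fixes a :: "int \<Rightarrow> real" and z :: complex
  assumes tnn: "totally_nonnegative (hurwitz_array a)"
    and supp: "\<And>i. i < 0 \<or> i > int n \<Longrightarrow> a i = 0" and pos: "a 0 > 0" "a (int n) > 0"
    and z: "Re z > 0" "Im z > 0"
  shows "(\<Sum>i\<le>n. of_real (a (int i)) * (1 / z) ^ i) \<noteq> 0"
proof
  assume root: "(\<Sum>i\<le>n. of_real (a (int i)) * (1 / z) ^ i) = 0"
  define K where "K = n + 2"
  define b where "b = (shift_add ^^ K) a"
  define \<theta> where "\<theta> = Arg z"
  define \<tau> where "\<tau> = pi / \<theta>"
  have "z \<noteq> 0" using z by auto
  have \<theta>: "0 < \<theta>" "\<theta> < pi / 2"
    using z Arg_lt_pi[of z] Arg_Re_pos[of z] by (auto simp: \<theta>_def)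
  have \<tau>: "\<tau> > 2" "\<tau> * \<theta> = pi"
    using \<theta> by (auto simp: \<tau>_def field_simps)
  define y where "y r = Im (z ^ r)" for r
  have y: "y r = cmod z ^ r * sin (real r * \<theta>)" for r
  proof -
    have "z = rcis (cmod z) \<theta>"
      unfolding \<theta>_def by (simp add: rcis_cmod_Arg)
    then have "z ^ r = rcis (cmod z ^ r) (real r * \<theta>)"
      by (metis DeMoivre2)
    then show ?thesis by (simp add: y_def)
  qed
  define u where "u i = Suc (nat \<lfloor>real i * \<tau>\<rfloor>)" for i
  have u_bounds: "real i * \<tau> < real (u i)" "real (u i) \<le> real i * \<tau> + 1" for i
  proof -
    have "0 \<le> real i * \<tau>" using \<tau> by simp
    then show "real i * \<tau> < real (u i)" "real (u i) \<le> real i * \<tau> + 1"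
      unfolding u_def by linarith+
  qed
  have u0: "u 0 = 1" by (simp add: u_def)
  have u_step: "u i + 2 \<le> u (Suc i)" for i
  proof -
    have "real i * \<tau> + 2 \<le> real (Suc i) * \<tau>" using \<tau> by (simp add: algebra_simps)
    then have "\<lfloor>real i * \<tau>\<rfloor> + 2 \<le> \<lfloor>real (Suc i) * \<tau>\<rfloor>" by linarith
    moreover have "\<lfloor>real i * \<tau>\<rfloor> \<ge> 0" using \<tau> by simp
    ultimately show ?thesis unfolding u_def by linarith
  qed
  have u_mono: "u i \<le> u l" if "i \<le> l" for i l
    using u_step by (intro lift_Suc_mono_le[OF _ that]) (metis add_leD1)
  \<comment> \<open>The window must hold \<open>G\<close> consecutive columns, which is possible for large \<open>G\<close> because the runs have
    average length \<open>\<tau> > 2\<close>.\<close>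
  obtain G where G: "2 * n + 2 * G + 2 \<le> u G" "G > 0"
  proof -
    obtain G :: nat where "(2 * n + 2) / (\<tau> - 2) < real G"
      using reals_Archimedean2 by blast
    then have "2 * n + 2 < real G * (\<tau> - 2)" using \<tau> by (simp add: field_simps)
    then have "2 * n + 2 + 2 * real G < real G * \<tau>" by (simp add: algebra_simps)
    then have "2 * n + 2 * G + 2 \<le> u G" using u_bounds(1)[of G] by linarith
    moreover have "G > 0" using calculation u0 by (cases G) auto
    ultimately show ?thesis using that by blast
  qed
  \<comment> \<open>With \<open>K = n + 2\<close> the column \<open>n + 2\<close> has its support in rows \<open>1\<close> to \<open>2 n + 3\<close>; the second argument of \<open>max\<close> is the least
    column whose support reaches down to row \<open>u i\<close>.\<close>
  define c where "c i = max (n + 2 + i) (u i div 2 + 1)" for i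
  have c_mono: "strict_mono_on {..<G} c"
  proof -
    have "c i < c (Suc i)" for i
      using u_step[of i] by (auto simp: c_def)
    then have "strict_mono c" by (rule strict_mono_Suc_iff[THEN iffD2, rule_format])
    then show ?thesis by (simp add: strict_mono_on_def strict_mono_def)
  qed
  have c_pos: "c ` {..<G} \<subseteq> {1..}" by (auto simp: c_def)
  have b_supp: "b i = 0" if "i < 0 \<or> i > int (n + K)" for i
    unfolding b_def by (rule shift_add_support[OF supp that])
  have b_root: "(\<Sum>i\<le>n + K. of_real (b (int i)) * (1 / z) ^ i) = 0"
    unfolding b_def by (rule shift_add_root[OF supp root])
  have b_tnn: "totally_nonnegative (hurwitz_array b)"
    unfolding b_def by (rule totally_nonnegative_shift_add[OF tnn])
  define w where "w i r = (if u i \<le> r \<and> r < u (Suc i) then \<bar>y r\<bar> else 0)" for i r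
  have sign: "sin (real r * \<theta>) = (-1) ^ i * sin (real r * \<theta> - real i * pi)" for r i
    by (simp add: sin_diff mult.assoc[symmetric] flip: power_add)
  have in_group: "0 < real r * \<theta> - real i * pi \<and> real r * \<theta> - real i * pi \<le> pi"
    if "u i \<le> r" "r < u (Suc i)" for i r
  proof -
    have "real i * \<tau> < real r" "real r \<le> real (Suc i) * \<tau>"
      using u_bounds(1)[of i] u_bounds(2)[of "Suc i"] that by linarith+
    then have "real i * \<tau> * \<theta> < real r * \<theta>" "real r * \<theta> \<le> real (Suc i) * \<tau> * \<theta>"
      using \<theta> by simp_all
    then show ?thesis using \<tau>(2) by (simp add: mult.assoc distrib_right)
  qed
  have abs_y: "(-1) ^ i * \<bar>y r\<bar> = y r" if "u i \<le> r" "r < u (Suc i)" for i r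
  proof -
    have "sin (real r * \<theta> - real i * pi) \<ge> 0"
      using in_group[OF that] by (intro sin_ge_zero) auto
    then have "\<bar>y r\<bar> = cmod z ^ r * sin (real r * \<theta> - real i * pi)"
      unfolding y sign[of r i] by (simp add: abs_mult power_abs)
    then show ?thesis unfolding y sign[of r i] by simp
  qed
  have y_nz: "y (u i) \<noteq> 0" for i
  proof -
    have "real (u i) * \<theta> \<le> (real i * \<tau> + 1) * \<theta>"
      using u_bounds(2)[of i] \<theta> by simp
    also have "\<dots> < real i * pi + pi" using \<theta> \<tau>(2) by (simp add: distrib_right mult.assoc)
    finally have "sin (real (u i) * \<theta> - real i * pi) > 0"
      using in_group[of i "u i"] u_step[of i] by (intro sin_gt_zero) auto
    then show ?thesis unfolding y sign[of "u i" i] using \<open>z \<noteq> 0\<close> by simp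
  qed
  have minor_pos: "minor (hurwitz_array b) G u c > 0"
  proof -
    \<comment> \<open>\<open>P i\<close> holds as long as row \<open>u i\<close> is at least \<open>n\<close> rows above the lower end of the
      support of column \<open>n + 2 + i\<close>; it is downward closed, so it defines the two phases.\<close>
    define P where "P i \<longleftrightarrow> u i + 1 + n \<le> 2 * (n + 2 + i)" for i
    have P_down: "P i" if "P l" "i \<le> l" for i l
      using that(2,1)
    proof (induction rule: dec_induct)
      case (step m)
      then show ?case using u_step[of m] by (simp add: P_def)
    qed
    define j where "j = (LEAST i. \<not> P i \<or> i \<ge> G)"
    have jG: "\<not> P j \<or> j \<ge> G"
      unfolding j_def by (rule LeastI[of _ G]) simp
    have upper: "2 * (n + 2 + i) \<le> u i + 2 * n + 3" for i
    proof (induction i)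
      case (Suc i)
      then show ?case using u_step[of i] by simp
    qed (simp add: u0)
    show ?thesis
      unfolding b_def
    proof (rule shift_add_minor_pos[OF tnn supp pos c_mono c_pos, where j = j])
      show "strict_mono_on {..<G} u"
      proof -
        have "u i < u (Suc i)" for i using u_step[of i] by simp
        then have "strict_mono u" by (rule strict_mono_Suc_iff[THEN iffD2, rule_format])
        then show ?thesis by (simp add: strict_mono_on_def strict_mono_def)
      qed
      show "u ` {..<G} \<subseteq> {1..}" by (auto simp: u_def)
      show "u i + 1 + n \<le> 2 * c i \<and> 2 * c i \<le> u i + 1 + n + K" if "i < j" "i < G" for i
      proof -
        have "P i" using not_less_Least[of i "\<lambda>i. \<not> P i \<or> i \<ge> G"] that by (auto simp: j_def)
        then show ?thesis using upper[of i] by (auto simp: P_def c_def K_def max_def)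
      qed
      show "u i + 1 \<le> 2 * c i \<and> 2 * c i \<le> u i + 1 + K" if "j \<le> i" "i < G" for i
      proof -
        have "\<not> P i" using jG P_down[of i j] that by auto
        then show ?thesis by (auto simp: P_def c_def K_def max_def)
      qed
    qed
  qed
  let ?S = "{1..<u G}"
  have w_eq: "(\<Sum>i<G. (-1) ^ i * w i r) = y r" if r: "r \<in> ?S" for r
  proof -
    obtain i where i: "i < G" "u i \<le> r" "r < u (Suc i)"
      using group_of_index[of u r G] r u0 by auto
    have "w l r = 0" if "l \<noteq> i" for l
      using i that u_mono[of "Suc l" i] u_mono[of "Suc i" l]
      by (cases "l < i") (auto simp: w_def)
    then have "(\<Sum>l<G. (-1) ^ l * w l r) = (\<Sum>l\<in>{i}. (-1) ^ l * w l r)"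
      using i by (intro sum.mono_neutral_right) auto
    then show ?thesis using i abs_y[OF i(2,3)] by (simp add: w_def)
  qed
  \<comment> \<open>Undoing the absolute values by the alternating signs recovers \<open>y\<close>, which the columns annihilate.\<close>
  have "Determinant.det (Matrix.mat G G (\<lambda>(i, l). \<Sum>r\<in>?S. w i r * hurwitz_array b r (c l))) = 0"
  proof (rule det_eq_0_left_kernel[where v = "\<lambda>i. (-1) ^ i"])
    fix l assume l: "l < G"
    have "(\<Sum>i<G. (-1) ^ i * (\<Sum>r\<in>?S. w i r * hurwitz_array b r (c l))) =
        (\<Sum>r\<in>?S. (\<Sum>i<G. (-1) ^ i * w i r) * hurwitz_array b r (c l))"
      unfolding sum_distrib_left sum_distrib_right by (subst sum.swap) (simp add: mult_ac)
    also have "\<dots> = (\<Sum>r\<in>?S. Im (z ^ r) * hurwitz_array b r (c l))"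
      by (rule sum.cong) (auto simp: w_eq y_def)
    also have "\<dots> = 0"
    proof (rule hurwitz_array_left_kernel[OF b_supp b_root \<open>z \<noteq> 0\<close>])
      show "n + K + 2 \<le> 2 * c l" by (auto simp: c_def K_def max_def)
      have "u l + 2 \<le> u G" using u_step[of l] u_mono[of "Suc l" G] l by simp
      then show "2 * c l \<le> u G" using G l by (auto simp: c_def max_def)
    qed
    finally show "(\<Sum>i<G. (-1) ^ i * (\<Sum>r\<in>?S. w i r * hurwitz_array b r (c l))) = 0" .
  qed (use G in auto)
  moreover have "(\<Prod>i<G. w i (u i)) * minor (hurwitz_array b) G u c \<le>
      Determinant.det (Matrix.mat G G (\<lambda>(i, l). \<Sum>r\<in>?S. w i r * hurwitz_array b r (c l)))"
  proof (rule det_row_combinations_ge[OF b_tnn _ _ c_mono c_pos])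
    show "r \<le> r'" if "i < l" "w i r \<noteq> 0" "w l r' \<noteq> 0" for i l r r'
      using that u_mono[of "Suc i" l] by (auto simp: w_def split: if_splits)
    show "u i \<in> ?S" if "i < G" for i
      using that u_step[of i] u_mono[of "Suc i" G] u_mono[of 0 i] u0 by auto
  qed (auto simp: w_def)
  moreover have "w i (u i) > 0" for i
    using y_nz[of i] u_step[of i] by (simp add: w_def)
  then have "(\<Prod>i<G. w i (u i)) > 0"
    by (intro prod_pos) auto
  ultimately show False
    using mult_pos_pos[OF _ minor_pos] by fastforce
qed

text \<open>Zeros at the origin make trailing coefficients vanish; the array depends on the
  coefficient sequence only, so \<open>n\<close> is chosen as the last index with a nonzero coefficient rather than
  as the degree.\<close>

theorem tnn_imp_quasi_stable:
  assumes lead: "desc_coeff p 0 > 0"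
    and tnn: "totally_nonnegative (hurwitz_array (desc_coeff p))"
  shows "quasi_stable (map_poly complex_of_real p)"
proof -
  let ?f = "map_poly complex_of_real p"
  let ?a = "desc_coeff p"
  have nonneg: "?a i \<ge> 0" if "i \<ge> 0" for i
    using totally_nonnegative_entry[OF tnn, of "nat i + 1" "nat i + 1"] that
    by (simp add: hurwitz_array_def)
  have f: "poly ?f z = (\<Sum>i\<le>degree p. of_real (?a (int i)) * z ^ (degree p - i))" for z
    by (simp add: poly_desc_coeff desc_coeff_def coeff_map_poly degree_map_poly)
  obtain n where n: "n \<le> degree p" "?a (int n) > 0" "\<And>i. i > int n \<Longrightarrow> ?a i = 0"
  proof -
    define n where "n = Max {i. i \<le> degree p \<and> ?a (int i) \<noteq> 0}"
    have n: "n \<in> {i. i \<le> degree p \<and> ?a (int i) \<noteq> 0}"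
      unfolding n_def using lead by (intro Max_in) (auto intro!: exI[of _ 0])
    show ?thesis
    proof (rule that)
      show "n \<le> degree p" "?a (int n) > 0"
        using n nonneg[of "int n"] by auto
      show "?a i = 0" if "i > int n" for i
      proof (rule ccontr)
        assume nz: "?a i \<noteq> 0"
        then have "nat i \<in> {i. i \<le> degree p \<and> ?a (int i) \<noteq> 0}"
          using that by (auto simp: desc_coeff_def split: if_splits)
        then have "nat i \<le> n" unfolding n_def by (intro Max_ge) auto
        with that show False by linarith
      qed
    qed
  qed
  have upper: "poly ?f z \<noteq> 0" if z: "Re z > 0" "Im z > 0" for z
  proof -
    have z0: "z \<noteq> 0" using z by auto
    have "poly ?f z = (\<Sum>i\<le>degree p. z ^ degree p * (of_real (?a (int i)) * (1 / z) ^ i))"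
      unfolding f using z0 by (intro sum.cong) (auto simp: power_diff power_divide)
    also have "\<dots> = z ^ degree p * (\<Sum>i\<le>n. of_real (?a (int i)) * (1 / z) ^ i)"
      unfolding sum_distrib_left[symmetric] using n
      by (intro arg_cong[where f = "\<lambda>x. z ^ degree p * x"] sum.mono_neutral_right) auto
    finally have "poly ?f z = z ^ degree p * (\<Sum>i\<le>n. of_real (?a (int i)) * (1 / z) ^ i)" .
    moreover have "?a i = 0" if "i < 0 \<or> i > int n" for i
      using that n(3)[of i] by (auto simp: desc_coeff_def)
    ultimately show ?thesis
      using tnn_no_root_in_right_half_plane[OF tnn _ lead n(2) z] z0
      by (simp del: of_real_eq_0_iff)
  qed
  have "poly ?f z \<noteq> 0" if z: "Re z > 0" for z
  proof -
    consider "Im z > 0" | "Im z < 0" | "Im z = 0" by linarith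
    then show ?thesis
    proof cases
      case 1
      with z show ?thesis by (rule upper)
    next
      case 2
      then have "poly ?f (cnj z) \<noteq> 0" using z by (intro upper) auto
      moreover have "cnj (poly ?f z) = poly ?f (cnj z)"
        by (rule poly_cnj_real) (auto simp: coeff_map_poly)
      ultimately show ?thesis by auto
    next
      case 3
      then have zr: "z = of_real (Re z)" by (simp add: complex_eq_iff)
      have "(\<Sum>i\<le>degree p. ?a (int i) * Re z ^ (degree p - i)) > 0"
        using z lead nonneg by (intro sum_pos2[of _ 0]) auto
      moreover have "poly ?f z = of_real (\<Sum>i\<le>degree p. ?a (int i) * Re z ^ (degree p - i))"
        unfolding f by (subst zr) simp
      ultimately show ?thesis by (metis less_irrefl of_real_eq_0_iff)
    qed
  qed
  then show ?thesis
    unfolding quasi_stable_def by (meson not_less)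
qed

theorem mainTheorem1:
  fixes p :: "real poly" and n :: nat
  assumes "degree p = n"
    and "desc_coeff p 0 > 0"
  shows "quasi_stable (map_poly complex_of_real p) \<longleftrightarrow>
         totally_nonnegative_on {1..} {1..} (infinite_hurwitz_matrix p)"
  unfolding infinite_hurwitz_matrix_eq
  using quasi_stable_imp_tnn[OF assms(2)] tnn_imp_quasi_stable[OF assms(2)] by blast

end
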